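(* Let $\delta$ be a renaming. Let $\Pi X.\, s\ [\exists\vec{x}.\,\varphi]$ and $\Pi Y.\, t\ [\exists\vec{y}.\,\psi]$ be satisfiable existentially constrained terms such that $s\delta = t$. Then $\Pi X.\, s\ [\exists\vec{x}.\,\varphi] \sim \Pi Y.\, t\ [\exists\vec{y}.\,\psi]$ if and only if $\delta(X) = Y$ and $\vDash_{\mathcal{M}} (\exists\vec{x}.\,\varphi)\delta \Leftrightarrow (\exists\vec{y}.\,\psi)$.
   Context: Fix a many-sorted signature whose sorts are partitioned into theory sorts and term sorts and whose function symbols are partitioned into theory symbols (all argument and result sorts are theory sorts) and term symbols; terms are built from these symbols and sorted variables. A fixed model $\mathcal{M}$ interprets theory sorts and theory symbols; the sort Bool is interpreted as $\{\mathsf{true},\mathsf{false}\}$, the usual connectives and equality are available as theory symbols, and every element of the interpretation of every theory sort is a constant symbol of the signature, called a value; $\mathcal{V}al$ is the set of values. A logical constraint is a Bool-sorted term built from theory symbols and variables. A valuation $\rho$ maps theory-sorted variables to elements of the interpretations of their sorts; $\vDash_{\mathcal{M},\rho}\varphi$ means $\varphi$ evaluates to true under $\rho$. Substitutions are sort-preserving; $\sigma|_U$ agrees with $\sigma$ on $U$ and is the identity elsewhere; $\sigma$ is $X$-valued if $\sigma(X)\subseteq\mathcal{V}al$. A renaming is a bijective substitution from variables to variables. $\mathcal{V}ar(\cdot)$ denotes the set of variables occurring in an expression. An existential constraint $\exists\vec{x}.\,\varphi$ is a pair of a sequence of variables $\vec{x}$ and a logical constraint $\varphi$ with $\{\vec{x}\}\subseteq\mathcal{V}ar(\varphi)$;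 its free variables are $\mathcal{FV}ar(\exists\vec{x}.\varphi)=\mathcal{V}ar(\varphi)\setminus\{\vec{x}\}$ and its bound variables are $\{\vec{x}\}$. $\vDash_{\mathcal{M},\rho}\exists\vec{x}.\varphi$ iff there are values $\vec{v}$ with $\vDash_{\mathcal{M},\rho}\varphi\{\vec{x}\mapsto\vec{v}\}$; the constraint is satisfiable if this holds for some $\rho$. For a substitution $\sigma$, $(\exists\vec{x}.\varphi)\sigma := \exists\vec{x}.(\varphi\,\sigma|_{\mathcal{FV}ar(\exists\vec{x}.\varphi)})$, and $\sigma\vDash_{\mathcal{M}}\exists\vec{x}.\varphi$ means $\sigma(\mathcal{FV}ar(\exists\vec{x}.\varphi))\subseteq\mathcal{V}al$ and $\vDash_{\mathcal{M},\rho}(\exists\vec{x}.\varphi)\sigma$ for all $\rho$. For existential constraints $A,B$, $\vDash_{\mathcal{M}} A\Leftrightarrow B$ means that for every valuation $\rho$, $\vDash_{\mathcal{M},\rho}A$ iff $\vDash_{\mathcal{M},\rho}B$. An existentially constrained term $\Pi X.\, s\ [\exists\vec{x}.\,\varphi]$ is a triple of a set $X$ of variables, a term $s$ and an existential constraint with $\mathcal{FV}ar(\exists\vec{x}.\varphi)\subseteq X\subseteq\mathcal{V}ar(s)$ and $\{\vec{x}\}\cap\mathcal{V}ar(s)=\emptyset$; it is satisfiable if its constraint is. $\Pi X.\, s\ [\exists\vec{x}.\varphi]$ is subsumed by $\Pi Y.\, t\ [\exists\vec{y}.\psi]$ if for every $X$-valued substitution $\sigma$ with $\sigma\vDash_{\mathcal{M}}\exists\vec{x}.\varphi$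 there is a $Y$-valued substitution $\gamma$ with $\gamma\vDash_{\mathcal{M}}\exists\vec{y}.\psi$ and $s\sigma=t\gamma$; the two are equivalent ($\sim$) if each is subsumed by the other.
   Formalization: Applying δ to ∃x.φ is capture-avoiding (bound variables are renamed first if needed; each sort has infinitely many variables), and the variables in X and Y are required to be theory-sorted; with literal substitution, or with term-sorted variables in X, the claim is false. *)

theory Defs
  imports Main
begin

datatype (funs: 'f, vars: 'v) trm = Var 'v | Fun 'f "('f, 'v) trm list"

text \<open>
  A signature together with its sorted variables and the fixed model. Sorts outside
  \<open>theory_sorts\<close> are the term sorts, symbols outside \<open>theory_syms\<close> the term symbols.
  Since every element of the model is itself a constant symbol, the carriers are sets of symbols.
\<close>
record ('s, 'f, 'v) lc_struct =
  theory_sorts :: "'s set"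
  theory_syms :: "'f set"
  arity :: "'f \<Rightarrow> 's list \<times> 's"
  var_sort :: "'v \<Rightarrow> 's"
  carrier :: "'s \<Rightarrow> 'f set"
  interp :: "'f \<Rightarrow> 'f list \<Rightarrow> 'f"
  bool_sort :: 's
  true_sym :: 'f
  false_sym :: 'f
  not_sym :: 'f
  and_sym :: 'f
  or_sym :: 'f
  imp_sym :: 'f
  iff_sym :: 'f
  eq_sym :: "'s \<Rightarrow> 'f"

definition is_connective2 :: "('s, 'f, 'v) lc_struct \<Rightarrow> 'f \<Rightarrow> (bool \<Rightarrow> bool \<Rightarrow> bool) \<Rightarrow> bool" where
  "is_connective2 M f b \<longleftrightarrow>
     f \<in> theory_syms M \<and> arity M f = ([bool_sort M, bool_sort M], bool_sort M) \<and>
     (\<forall>p \<in> carrier M (bool_sort M). \<forall>q \<in> carrier M (bool_sort M).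
        interp M f [p, q] = (if b (p = true_sym M) (q = true_sym M) then true_sym M else false_sym M))"

text \<open>Infinitely many variables of each sort ensure that bound variables can be renamed apart.\<close>

definition signature :: "('s, 'f, 'v) lc_struct \<Rightarrow> bool" where
  "signature M \<longleftrightarrow>
     (\<forall>f \<in> theory_syms M. set (fst (arity M f)) \<subseteq> theory_sorts M \<and> snd (arity M f) \<in> theory_sorts M) \<and>
     (\<forall>\<tau>. infinite {v. var_sort M v = \<tau>})"

definition model :: "('s, 'f, 'v) lc_struct \<Rightarrow> bool" where
  "model M \<longleftrightarrow>
     (\<forall>f \<in> theory_syms M. \<forall>as. list_all2 (\<lambda>a \<tau>. a \<in> carrier M \<tau>) as (fst (arity M f)) \<longrightarrow>
        interp M f as \<in> carrier M (snd (arity M f))) \<and>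
     (\<forall>\<tau> \<in> theory_sorts M. \<forall>c \<in> carrier M \<tau>.
        c \<in> theory_syms M \<and> arity M c = ([], \<tau>) \<and> interp M c [] = c)"

definition boolean_structure :: "('s, 'f, 'v) lc_struct \<Rightarrow> bool" where
  "boolean_structure M \<longleftrightarrow>
     bool_sort M \<in> theory_sorts M \<and> carrier M (bool_sort M) = {true_sym M, false_sym M} \<and> true_sym M \<noteq> false_sym M \<and>
     not_sym M \<in> theory_syms M \<and> arity M (not_sym M) = ([bool_sort M], bool_sort M) \<and>
     interp M (not_sym M) [true_sym M] = false_sym M \<and> interp M (not_sym M) [false_sym M] = true_sym M \<and>
     is_connective2 M (and_sym M) (\<and>) \<and> is_connective2 M (or_sym M) (\<or>) \<and>
     is_connective2 M (imp_sym M) (\<longrightarrow>) \<and> is_connective2 M (iff_sym M) (\<longleftrightarrow>) \<and>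
     (\<forall>\<tau> \<in> theory_sorts M.
        eq_sym M \<tau> \<in> theory_syms M \<and> arity M (eq_sym M \<tau>) = ([\<tau>, \<tau>], bool_sort M) \<and>
        (\<forall>a \<in> carrier M \<tau>. \<forall>b \<in> carrier M \<tau>.
           interp M (eq_sym M \<tau>) [a, b] = (if a = b then true_sym M else false_sym M)))"

definition lc_structure :: "('s, 'f, 'v) lc_struct \<Rightarrow> bool" where
  "lc_structure M \<longleftrightarrow> signature M \<and> model M \<and> boolean_structure M"

inductive has_sort :: "('s, 'f, 'v) lc_struct \<Rightarrow> ('f, 'v) trm \<Rightarrow> 's \<Rightarrow> bool" for M where
  "has_sort M (Var v) (var_sort M v)"
| "arity M f = (\<tau>s, \<tau>) \<Longrightarrow> list_all2 (has_sort M) ts \<tau>s \<Longrightarrow> has_sort M (Fun f ts) \<tau>"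

definition is_term :: "('s, 'f, 'v) lc_struct \<Rightarrow> ('f, 'v) trm \<Rightarrow> bool" where
  "is_term M t \<longleftrightarrow> (\<exists>\<tau>. has_sort M t \<tau>)"

definition Val :: "('s, 'f, 'v) lc_struct \<Rightarrow> ('f, 'v) trm set" where
  "Val M = {Fun c [] | c \<tau>. \<tau> \<in> theory_sorts M \<and> c \<in> carrier M \<tau>}"

definition logical_constraint :: "('s, 'f, 'v) lc_struct \<Rightarrow> ('f, 'v) trm \<Rightarrow> bool" where
  "logical_constraint M \<phi> \<longleftrightarrow> has_sort M \<phi> (bool_sort M) \<and> funs \<phi> \<subseteq> theory_syms M"

definition valuation :: "('s, 'f, 'v) lc_struct \<Rightarrow> ('v \<Rightarrow> 'f) \<Rightarrow> bool" where
  "valuation M \<rho> \<longleftrightarrow> (\<forall>v. var_sort M v \<in> theory_sorts M \<longrightarrow> \<rho> v \<in> carrier M (var_sort M v))"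

primrec evaluate :: "('s, 'f, 'v) lc_struct \<Rightarrow> ('v \<Rightarrow> 'f) \<Rightarrow> ('f, 'v) trm \<Rightarrow> 'f" where
  "evaluate M \<rho> (Var v) = \<rho> v"
| "evaluate M \<rho> (Fun f ts) = interp M f (map (evaluate M \<rho>) ts)"

type_synonym ('f, 'v) subst = "'v \<Rightarrow> ('f, 'v) trm"

primrec subst_apply :: "('f, 'v) trm \<Rightarrow> ('f, 'v) subst \<Rightarrow> ('f, 'v) trm" (infixl \<open>\<cdot>\<close> 67) where
  "Var v \<cdot> \<sigma> = \<sigma> v"
| "Fun f ts \<cdot> \<sigma> = Fun f (map (\<lambda>t. t \<cdot> \<sigma>) ts)"

definition substitution :: "('s, 'f, 'v) lc_struct \<Rightarrow> ('f, 'v) subst \<Rightarrow> bool" where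
  "substitution M \<sigma> \<longleftrightarrow> (\<forall>v. has_sort M (\<sigma> v) (var_sort M v))"

definition subst_restrict :: "('f, 'v) subst \<Rightarrow> 'v set \<Rightarrow> ('f, 'v) subst" where
  "subst_restrict \<sigma> U = (\<lambda>v. if v \<in> U then \<sigma> v else Var v)"

definition valued :: "('s, 'f, 'v) lc_struct \<Rightarrow> 'v set \<Rightarrow> ('f, 'v) subst \<Rightarrow> bool" where
  "valued M X \<sigma> \<longleftrightarrow> \<sigma> ` X \<subseteq> Val M"

definition renaming :: "('s, 'f, 'v) lc_struct \<Rightarrow> ('f, 'v) subst \<Rightarrow> bool" where
  "renaming M \<delta> \<longleftrightarrow> substitution M \<delta> \<and> bij_betw \<delta> UNIV (range Var)"

text \<open>The pair \<open>(xs, \<phi>)\<close> stands for $\exists \vec{x}.\,\varphi$.\<close>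

type_synonym ('f, 'v) ex_constraint = "'v list \<times> ('f, 'v) trm"

definition ex_constraint :: "('s, 'f, 'v) lc_struct \<Rightarrow> ('f, 'v) ex_constraint \<Rightarrow> bool" where
  "ex_constraint M E \<longleftrightarrow> logical_constraint M (snd E) \<and> set (fst E) \<subseteq> vars (snd E)"

definition BVar :: "('f, 'v) ex_constraint \<Rightarrow> 'v set" where
  "BVar E = set (fst E)"

definition FVar :: "('f, 'v) ex_constraint \<Rightarrow> 'v set" where
  "FVar E = vars (snd E) - set (fst E)"

definition value_subst :: "'v list \<Rightarrow> 'f list \<Rightarrow> ('f, 'v) subst" where
  "value_subst xs cs = (\<lambda>v. case map_of (zip xs cs) v of None \<Rightarrow> Var v | Some c \<Rightarrow> Fun c [])"

definition holds :: "('s, 'f, 'v) lc_struct \<Rightarrow> ('v \<Rightarrow> 'f) \<Rightarrow> ('f, 'v) ex_constraint \<Rightarrow> bool" where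
  "holds M \<rho> E \<longleftrightarrow>
     (\<exists>cs. list_all2 (\<lambda>c x. c \<in> carrier M (var_sort M x)) cs (fst E) \<and>
           evaluate M \<rho> (snd E \<cdot> value_subst (fst E) cs) = true_sym M)"

definition satisfiable :: "('s, 'f, 'v) lc_struct \<Rightarrow> ('f, 'v) ex_constraint \<Rightarrow> bool" where
  "satisfiable M E \<longleftrightarrow> (\<exists>\<rho>. valuation M \<rho> \<and> holds M \<rho> E)"

definition constraint_equiv ::
  "('s, 'f, 'v) lc_struct \<Rightarrow> ('f, 'v) ex_constraint \<Rightarrow> ('f, 'v) ex_constraint \<Rightarrow> bool" where
  "constraint_equiv M A B \<longleftrightarrow> (\<forall>\<rho>. valuation M \<rho> \<longrightarrow> (holds M \<rho> A \<longleftrightarrow> holds M \<rho> B))"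

text \<open>
  Application of a substitution to $\exists \vec{x}.\,\varphi$ is
  $\exists \vec{x}.\,(\varphi\,\sigma|_{\mathcal{FV}ar})$, under the usual convention that bound
  variables are first renamed if some variable introduced by \<open>\<sigma>\<close> would be captured. Without
  renaming, the swap of \<open>z\<close> and \<open>w\<close> would turn $\exists w.\, z < w$ into $\exists w.\, w < w$.
\<close>

definition capture_free :: "('f, 'v) subst \<Rightarrow> ('f, 'v) ex_constraint \<Rightarrow> bool" where
  "capture_free \<sigma> E \<longleftrightarrow> (\<forall>v \<in> FVar E. vars (\<sigma> v) \<inter> BVar E = {})"

definition bound_variant ::
  "('s, 'f, 'v) lc_struct \<Rightarrow> ('f, 'v) ex_constraint \<Rightarrow> ('f, 'v) ex_constraint \<Rightarrow> bool" where
  "bound_variant M E E' \<longleftrightarrow>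
     (\<exists>\<zeta>. inj_on \<zeta> (BVar E) \<and> \<zeta> ` BVar E \<inter> FVar E = {} \<and>
          (\<forall>x \<in> BVar E. var_sort M (\<zeta> x) = var_sort M x) \<and>
          E' = (map \<zeta> (fst E), snd E \<cdot> subst_restrict (\<lambda>v. Var (\<zeta> v)) (BVar E)))"

definition avoid_capture ::
  "('s, 'f, 'v) lc_struct \<Rightarrow> ('f, 'v) subst \<Rightarrow> ('f, 'v) ex_constraint \<Rightarrow> ('f, 'v) ex_constraint" where
  "avoid_capture M \<sigma> E =
     (if capture_free \<sigma> E then E else SOME E'. bound_variant M E E' \<and> capture_free \<sigma> E')"

definition ex_subst ::
  "('s, 'f, 'v) lc_struct \<Rightarrow> ('f, 'v) ex_constraint \<Rightarrow> ('f, 'v) subst \<Rightarrow> ('f, 'v) ex_constraint" where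
  "ex_subst M E \<sigma> =
     (let E' = avoid_capture M \<sigma> E in (fst E', snd E' \<cdot> subst_restrict \<sigma> (FVar E')))"

definition entails :: "('s, 'f, 'v) lc_struct \<Rightarrow> ('f, 'v) subst \<Rightarrow> ('f, 'v) ex_constraint \<Rightarrow> bool" where
  "entails M \<sigma> E \<longleftrightarrow>
     \<sigma> ` FVar E \<subseteq> Val M \<and> (\<forall>\<rho>. valuation M \<rho> \<longrightarrow> holds M \<rho> (ex_subst M E \<sigma>))"

text \<open>
  The triple \<open>(X, s, E)\<close> stands for $\Pi X.\, s\ [E]$. The variables in \<open>X\<close> are theory-sorted:
  they are to be instantiated by values, so that with a term-sorted variable in \<open>X\<close> there
  would be no \<open>X\<close>-valued substitution at all.
\<close>

type_synonym ('f, 'v) ex_term = "'v set \<times> ('f, 'v) trm \<times> ('f, 'v) ex_constraint"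

definition ex_constrained_term :: "('s, 'f, 'v) lc_struct \<Rightarrow> ('f, 'v) ex_term \<Rightarrow> bool" where
  "ex_constrained_term M = (\<lambda>(X, s, E).
     is_term M s \<and> ex_constraint M E \<and> (\<forall>v \<in> X. var_sort M v \<in> theory_sorts M) \<and>
     FVar E \<subseteq> X \<and> X \<subseteq> vars s \<and> BVar E \<inter> vars s = {})"

definition satisfiable_term :: "('s, 'f, 'v) lc_struct \<Rightarrow> ('f, 'v) ex_term \<Rightarrow> bool" where
  "satisfiable_term M = (\<lambda>(X, s, E). satisfiable M E)"

definition subsumed :: "('s, 'f, 'v) lc_struct \<Rightarrow> ('f, 'v) ex_term \<Rightarrow> ('f, 'v) ex_term \<Rightarrow> bool" where
  "subsumed M = (\<lambda>(X, s, E) (Y, t, F).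
     \<forall>\<sigma>. substitution M \<sigma> \<and> valued M X \<sigma> \<and> entails M \<sigma> E \<longrightarrow>
       (\<exists>\<gamma>. substitution M \<gamma> \<and> valued M Y \<gamma> \<and> entails M \<gamma> F \<and> s \<cdot> \<sigma> = t \<cdot> \<gamma>))"

definition equivalent :: "('s, 'f, 'v) lc_struct \<Rightarrow> ('f, 'v) ex_term \<Rightarrow> ('f, 'v) ex_term \<Rightarrow> bool" where
  "equivalent M S T \<longleftrightarrow> subsumed M S T \<and> subsumed M T S"

end

theory Submission
  imports Defs
begin

text \<open>
  Satisfaction of $\exists\vec{x}.\,\varphi$ under \<open>\<rho>\<close> means that some assignment differing from \<open>\<rho>\<close>
  at most on $\vec{x}$ makes $\varphi$ true; in this form, capture-avoiding substitution amounts to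
  composing the valuation with the substitution. Consequently a substitution that acts on the free
  variables like a valuation \<open>\<rho>\<close> entails the constraint iff \<open>\<rho>\<close> satisfies it.

  Given equivalence, instantiate \<open>s\<close> by a satisfying valuation on \<open>X\<close> and by the identity elsewhere.
  A matching instance of \<open>t = s\<delta>\<close> is then forced on all variables of \<open>t\<close>, so that values can only
  occur there at the images of \<open>X\<close>: this yields $Y \subseteq \delta(X)$ and transports
  satisfaction from one constraint to the other. The remaining half is symmetric. Conversely,
  composing with \<open>\<delta>\<close> or its inverse turns the instances of either term into those of the other.
\<close>

section \<open>Terms, substitution and evaluation\<close>

lemma evaluate_cong:
  "(\<And>v. v \<in> vars t \<Longrightarrow> \<rho> v = \<rho>' v) \<Longrightarrow> evaluate M \<rho> t = evaluate M \<rho>' t"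
proof (induction t)
  case (Fun f ts)
  then have "map (evaluate M \<rho>) ts = map (evaluate M \<rho>') ts" by auto
  then show ?case by (metis evaluate.simps(2))
qed simp

lemma evaluate_subst: "evaluate M \<rho> (t \<cdot> \<sigma>) = evaluate M (\<lambda>v. evaluate M \<rho> (\<sigma> v)) t"
proof (induction t)
  case (Fun f ts)
  then have "map (evaluate M \<rho> \<circ> (\<lambda>t. t \<cdot> \<sigma>)) ts = map (evaluate M (\<lambda>v. evaluate M \<rho> (\<sigma> v))) ts"
    by auto
  then show ?case by (simp only: evaluate.simps subst_apply.simps map_map)
qed simp

lemma subst_eq_iff: "t \<cdot> \<sigma> = t \<cdot> \<tau> \<longleftrightarrow> (\<forall>v \<in> vars t. \<sigma> v = \<tau> v)"
  by (induction t) auto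

lemma vars_subst: "vars (t \<cdot> \<sigma>) = (\<Union>v \<in> vars t. vars (\<sigma> v))"
  by (induction t) auto

lemma subst_subst: "t \<cdot> \<sigma> \<cdot> \<tau> = t \<cdot> (\<lambda>v. \<sigma> v \<cdot> \<tau>)"
  by (induction t) auto

lemma finite_vars: "finite (vars t)"
  by (induction t) auto

text \<open>Theory symbols take arguments of theory sorts only, so the property passes from the root
  down to the variables. It matters because \<open>valuation\<close> controls only theory-sorted
  variables.\<close>

lemma theory_sorted_vars:
  assumes "signature M"
  shows "has_sort M t \<tau> \<Longrightarrow> funs t \<subseteq> theory_syms M \<Longrightarrow> \<tau> \<in> theory_sorts M \<Longrightarrow>
    v \<in> vars t \<Longrightarrow> var_sort M v \<in> theory_sorts M"
proof (induction rule: has_sort.induct)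
  case (2 f \<tau>s \<tau> ts)
  then obtain u where u: "u \<in> set ts" "v \<in> vars u" by auto
  then obtain i where i: "i < length ts" "u = ts ! i" by (metis in_set_conv_nth)
  have "f \<in> theory_syms M" using 2 by simp
  then have "set \<tau>s \<subseteq> theory_sorts M" using assms 2(1) by (force simp: signature_def)
  moreover have "i < length \<tau>s" using i 2(2) by (simp add: list_all2_conv_all_nth)
  ultimately have "\<tau>s ! i \<in> theory_sorts M" by auto
  moreover have "funs (ts ! i) \<subseteq> theory_syms M" using u(1) i(2) "2.prems"(1) by (simp add: UN_subset_iff)
  ultimately show ?case using 2(2) i u by (auto simp: list_all2_conv_all_nth)
qed auto

lemma ex_constraint_theory_sorted:
  assumes "lc_structure M" and "ex_constraint M E" and "v \<in> vars (snd E)"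
  shows "var_sort M v \<in> theory_sorts M"
  using assms theory_sorted_vars[of M "snd E" "bool_sort M" v]
  by (auto simp: lc_structure_def ex_constraint_def logical_constraint_def boolean_structure_def)

lemma interp_value:
  "\<lbrakk>lc_structure M; \<tau> \<in> theory_sorts M; c \<in> carrier M \<tau>\<rbrakk> \<Longrightarrow> interp M c [] = c"
  by (auto simp: lc_structure_def model_def)

lemma has_sort_value:
  "\<lbrakk>lc_structure M; \<tau> \<in> theory_sorts M; c \<in> carrier M \<tau>\<rbrakk> \<Longrightarrow> has_sort M (Fun c []) \<tau>"
  by (rule has_sort.intros(2)[of _ _ "[]"]) (auto simp: lc_structure_def model_def)

text \<open>\<open>model\<close> fixes the arity of a carrier element to the sort of its carrier, so
  a value cannot be well-sorted at any other sort.\<close>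

lemma Val_of_sortE:
  assumes "lc_structure M" and "t \<in> Val M" and "has_sort M t \<tau>"
  obtains c where "t = Fun c []" and "\<tau> \<in> theory_sorts M" and "c \<in> carrier M \<tau>"
proof -
  obtain c \<tau>' where c: "t = Fun c []" "\<tau>' \<in> theory_sorts M" "c \<in> carrier M \<tau>'"
    using assms(2) by (auto simp: Val_def)
  have "\<tau> = \<tau>'"
    using assms(3) c assms(1)
    by (auto simp: lc_structure_def model_def elim!: has_sort.cases)
  with c that show thesis by blast
qed

section \<open>Semantics of existential constraints\<close>

text \<open>Value constants at theory sorts evaluate to themselves, so substituting values for the
  bound variables has the same effect as updating the valuation there.\<close>

lemma holds_iff:
  assumes M: "lc_structure M" and ts: "\<And>x. x \<in> BVar E \<Longrightarrow> var_sort M x \<in> theory_sorts M"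
  shows "holds M \<rho> E \<longleftrightarrow>
    (\<exists>\<rho>'. (\<forall>v. v \<notin> BVar E \<longrightarrow> \<rho>' v = \<rho> v) \<and> (\<forall>x \<in> BVar E. \<rho>' x \<in> carrier M (var_sort M x)) \<and>
          evaluate M \<rho>' (snd E) = true_sym M)"
    (is "?L \<longleftrightarrow> ?R")
proof
  assume ?L
  then obtain cs where cs: "list_all2 (\<lambda>c x. c \<in> carrier M (var_sort M x)) cs (fst E)"
    and ev: "evaluate M \<rho> (snd E \<cdot> value_subst (fst E) cs) = true_sym M"
    by (auto simp: holds_def)
  let ?r = "\<lambda>v. evaluate M \<rho> (value_subst (fst E) cs v)"
  have len: "length (fst E) = length cs" using cs by (simp add: list_all2_lengthD)
  have "?r v = \<rho> v" if "v \<notin> BVar E" for v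
  proof -
    have "map_of (zip (fst E) cs) v = None"
      using that len by (simp add: BVar_def)
    then show ?thesis by (simp add: value_subst_def)
  qed
  moreover have "?r x \<in> carrier M (var_sort M x)" if x: "x \<in> BVar E" for x
  proof -
    obtain c where c: "map_of (zip (fst E) cs) x = Some c"
      using x len by (metis BVar_def map_of_zip_is_Some)
    then have "(x, c) \<in> set (zip (fst E) cs)" by (rule map_of_SomeD)
    then have "c \<in> carrier M (var_sort M x)"
      using cs by (auto simp: set_zip list_all2_conv_all_nth)
    then show ?thesis using c interp_value[OF M ts[OF x]] by (simp add: value_subst_def)
  qed
  ultimately show ?R using ev unfolding evaluate_subst by (intro exI[of _ ?r]) blast
next
  assume ?R
  then obtain \<rho>' where off: "\<And>v. v \<notin> BVar E \<Longrightarrow> \<rho>' v = \<rho> v"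
    and on: "\<And>x. x \<in> BVar E \<Longrightarrow> \<rho>' x \<in> carrier M (var_sort M x)"
    and ev: "evaluate M \<rho>' (snd E) = true_sym M" by blast
  \<comment> \<open>Reading the list off a function gives repeated entries of \<open>fst E\<close>
    the same value, so it does not matter which of them \<open>map_of\<close> finds.\<close>
  let ?cs = "map \<rho>' (fst E)"
  have "evaluate M \<rho> (value_subst (fst E) ?cs v) = \<rho>' v" for v
  proof (cases "v \<in> BVar E")
    case True
    then have "map_of (zip (fst E) ?cs) v = Some (\<rho>' v)"
      by (simp add: BVar_def map_of_zip_map)
    then show ?thesis using interp_value[OF M ts[OF True] on[OF True]] by (simp add: value_subst_def)
  next
    case False
    then have "map_of (zip (fst E) ?cs) v = None" by (simp add: BVar_def)
    then show ?thesis using off[OF False]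
      by (simp only: value_subst_def option.case evaluate.simps)
  qed
  then have "evaluate M \<rho> (snd E \<cdot> value_subst (fst E) ?cs) = true_sym M"
    using ev by (simp add: evaluate_subst)
  moreover have "list_all2 (\<lambda>c x. c \<in> carrier M (var_sort M x)) ?cs (fst E)"
    using on by (auto simp: list_all2_conv_all_nth BVar_def)
  ultimately show ?L unfolding holds_def by blast
qed

lemma holds_cong:
  assumes "lc_structure M" and "\<And>x. x \<in> BVar E \<Longrightarrow> var_sort M x \<in> theory_sorts M"
    and eq: "\<And>v. v \<in> FVar E \<Longrightarrow> \<rho> v = \<rho>' v"
  shows "holds M \<rho> E \<longleftrightarrow> holds M \<rho>' E"
proof -
  \<comment> \<open>The hypothesis is symmetric in the two valuations, so one implication for
    arbitrary ones suffices. The witness is kept on the bound variables and replaced by the new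
    valuation elsewhere.\<close>
  have "holds M \<rho>2 E" if h: "holds M \<rho>1 E" and eq: "\<And>v. v \<in> FVar E \<Longrightarrow> \<rho>1 v = \<rho>2 v" for \<rho>1 \<rho>2
  proof -
    obtain \<rho>' where \<rho>': "\<And>v. v \<notin> BVar E \<Longrightarrow> \<rho>' v = \<rho>1 v"
      "\<And>x. x \<in> BVar E \<Longrightarrow> \<rho>' x \<in> carrier M (var_sort M x)" "evaluate M \<rho>' (snd E) = true_sym M"
      using h holds_iff[OF assms(1,2)] by blast
    let ?r = "\<lambda>v. if v \<in> BVar E then \<rho>' v else \<rho>2 v"
    have "evaluate M ?r (snd E) = evaluate M \<rho>' (snd E)"
      by (rule evaluate_cong) (use \<rho>'(1) eq in \<open>auto simp: FVar_def BVar_def\<close>)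
    then show ?thesis using \<rho>' by (subst holds_iff[OF assms(1,2)]) (auto intro!: exI[of _ ?r])
  qed
  then show ?thesis using eq by metis
qed

text \<open>Without capture, the terms put in for free variables contain no bound variable, so
  choosing witnesses for the bound variables does not change their values.\<close>

lemma holds_capture_free_subst:
  assumes "lc_structure M" and ts: "\<And>x. x \<in> BVar E \<Longrightarrow> var_sort M x \<in> theory_sorts M"
    and cf: "capture_free \<sigma> E"
  shows "holds M \<rho> (fst E, snd E \<cdot> subst_restrict \<sigma> (FVar E)) \<longleftrightarrow>
    holds M (\<lambda>v. evaluate M \<rho> (\<sigma> v)) E"
proof -
  let ?\<rho> = "\<lambda>v. evaluate M \<rho> (\<sigma> v)" and ?E = "(fst E, snd E \<cdot> subst_restrict \<sigma> (FVar E))"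
  have B: "BVar ?E = BVar E" by (simp add: BVar_def)
  \<comment> \<open>Witnesses for the two constraints correspond: they share the bound part, while
    the free part is \<open>\<rho>\<close> on one side and its composite with
    \<open>\<sigma>\<close> on the other.\<close>
  have ev: "evaluate M \<rho>' (snd ?E) = evaluate M (\<lambda>v. if v \<in> BVar E then \<rho>' v else ?\<rho> v) (snd E)"
    if "\<And>v. v \<notin> BVar E \<Longrightarrow> \<rho>' v = \<rho> v" for \<rho>'
  proof -
    have "evaluate M \<rho>' (\<sigma> v) = ?\<rho> v" if "v \<in> FVar E" for v
      by (rule evaluate_cong)
        (use \<open>\<And>v. v \<notin> BVar E \<Longrightarrow> \<rho>' v = \<rho> v\<close> cf that in \<open>auto simp: capture_free_def\<close>)
    then show ?thesis unfolding snd_conv evaluate_subst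
      by (intro evaluate_cong) (auto simp: subst_restrict_def FVar_def BVar_def)
  qed
  show ?thesis
  proof
    assume "holds M \<rho> ?E"
    then obtain \<rho>' where \<rho>': "\<And>v. v \<notin> BVar E \<Longrightarrow> \<rho>' v = \<rho> v"
      "\<And>x. x \<in> BVar E \<Longrightarrow> \<rho>' x \<in> carrier M (var_sort M x)" "evaluate M \<rho>' (snd ?E) = true_sym M"
      using holds_iff[of M ?E] assms(1) ts unfolding B by blast
    then show "holds M ?\<rho> E" using ev[OF \<rho>'(1)]
      by (intro holds_iff[OF assms(1) ts, THEN iffD2]
          exI[of _ "\<lambda>v. if v \<in> BVar E then \<rho>' v else ?\<rho> v"]) simp_all
  next
    assume "holds M ?\<rho> E"
    then obtain \<rho>' where \<rho>': "\<And>v. v \<notin> BVar E \<Longrightarrow> \<rho>' v = ?\<rho> v"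
      "\<And>x. x \<in> BVar E \<Longrightarrow> \<rho>' x \<in> carrier M (var_sort M x)" "evaluate M \<rho>' (snd E) = true_sym M"
      using holds_iff[OF assms(1) ts, THEN iffD1] by blast
    let ?r = "\<lambda>v. if v \<in> BVar E then \<rho>' v else \<rho> v"
    have "(\<lambda>v. if v \<in> BVar E then ?r v else ?\<rho> v) = \<rho>'" using \<rho>'(1) by auto
    then have "evaluate M ?r (snd ?E) = true_sym M" using ev[of ?r] \<rho>'(3) by simp
    then show "holds M \<rho> ?E" using \<rho>'(2) holds_iff[of M ?E \<rho>] assms(1) ts unfolding B
      by (auto intro!: exI[of _ ?r])
  qed
qed

section \<open>Renaming bound variables and capture-avoiding substitution\<close>

lemma FVar_bound_variant:
  assumes "ex_constraint M E" and "bound_variant M E E'"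
  shows "FVar E' = FVar E"
  using assms
  by (fastforce simp: bound_variant_def ex_constraint_def FVar_def BVar_def vars_subst
      subst_restrict_def split: if_splits)

text \<open>Witnesses travel along \<open>\<zeta>\<close> in one direction and along its inverse on
  \<open>BVar E\<close> in the other; disjointness from \<open>FVar E\<close> keeps the free
  variables undisturbed.\<close>

lemma holds_bound_variant:
  assumes M: "lc_structure M" and ts: "\<And>x. x \<in> BVar E \<Longrightarrow> var_sort M x \<in> theory_sorts M"
    and bv: "bound_variant M E E'"
  shows "holds M \<rho> E' \<longleftrightarrow> holds M \<rho> E"
proof -
  obtain \<zeta> where inj: "inj_on \<zeta> (BVar E)" and disj: "\<zeta> ` BVar E \<inter> FVar E = {}"
    and srt: "\<And>x. x \<in> BVar E \<Longrightarrow> var_sort M (\<zeta> x) = var_sort M x"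
    and E': "E' = (map \<zeta> (fst E), snd E \<cdot> subst_restrict (\<lambda>v. Var (\<zeta> v)) (BVar E))"
    using bv by (auto simp: bound_variant_def)
  have B: "BVar E' = \<zeta> ` BVar E" by (simp add: BVar_def E')
  have ts': "\<And>x. x \<in> BVar E' \<Longrightarrow> var_sort M x \<in> theory_sorts M" using ts srt B by auto
  have ev: "evaluate M \<rho>1 (snd E') = evaluate M \<rho>2 (snd E)"
    if "\<And>x. x \<in> BVar E \<Longrightarrow> \<rho>1 (\<zeta> x) = \<rho>2 x" and "\<And>v. v \<in> FVar E \<Longrightarrow> \<rho>1 v = \<rho>2 v" for \<rho>1 \<rho>2
    unfolding E' snd_conv evaluate_subst
    by (rule evaluate_cong) (use that in \<open>auto simp: subst_restrict_def FVar_def BVar_def\<close>)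
  show ?thesis
  proof
    assume "holds M \<rho> E'"
    then obtain \<rho>' where \<rho>': "\<And>v. v \<notin> BVar E' \<Longrightarrow> \<rho>' v = \<rho> v"
      "\<And>x. x \<in> BVar E' \<Longrightarrow> \<rho>' x \<in> carrier M (var_sort M x)" "evaluate M \<rho>' (snd E') = true_sym M"
      using holds_iff[OF M ts'] by blast
    let ?r = "\<lambda>v. if v \<in> BVar E then \<rho>' (\<zeta> v) else \<rho> v"
    have "evaluate M \<rho>' (snd E') = evaluate M ?r (snd E)"
    proof (rule ev)
      fix v assume v: "v \<in> FVar E"
      then have "v \<notin> BVar E'" "v \<notin> BVar E" using disj B by (auto simp: FVar_def BVar_def)
      then show "\<rho>' v = ?r v" using \<rho>'(1) by simp
    qed simp
    then show "holds M \<rho> E" using \<rho>' srt B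
      by (subst holds_iff[OF M ts]) (auto intro!: exI[of _ ?r], metis imageI)
  next
    assume "holds M \<rho> E"
    then obtain \<rho>' where \<rho>': "\<And>v. v \<notin> BVar E \<Longrightarrow> \<rho>' v = \<rho> v"
      "\<And>x. x \<in> BVar E \<Longrightarrow> \<rho>' x \<in> carrier M (var_sort M x)" "evaluate M \<rho>' (snd E) = true_sym M"
      using holds_iff[OF M ts] by blast
    let ?r = "\<lambda>v. if v \<in> BVar E' then \<rho>' (inv_into (BVar E) \<zeta> v) else \<rho> v"
    have "evaluate M ?r (snd E') = evaluate M \<rho>' (snd E)"
    proof (rule ev)
      fix v assume v: "v \<in> FVar E"
      then have "v \<notin> BVar E'" "v \<notin> BVar E" using disj B by (auto simp: FVar_def BVar_def)
      then show "?r v = \<rho>' v" using \<rho>'(1) by simp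
    qed (use inj B in auto)
    then show "holds M \<rho> E'" using \<rho>' srt B inj
      by (subst holds_iff[OF M ts']) (auto intro!: exI[of _ ?r])
  qed
qed

text \<open>Each fibre of \<open>g\<close> is infinite and only finitely many elements are excluded
  at any stage, so images can be picked one by one.\<close>

lemma fresh_sort_preserving_renaming:
  assumes inf: "\<And>\<tau>. infinite {v. g v = \<tau>}" and "finite B" and A: "finite A"
  shows "\<exists>\<zeta>. inj_on \<zeta> B \<and> \<zeta> ` B \<inter> A = {} \<and> (\<forall>x \<in> B. g (\<zeta> x) = g x)"
  using assms(2)
proof (induction B rule: finite_induct)
  case (insert b B)
  then obtain \<zeta> where \<zeta>: "inj_on \<zeta> B" "\<zeta> ` B \<inter> A = {}" "\<forall>x \<in> B. g (\<zeta> x) = g x" by blast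
  have "infinite ({v. g v = g b} - (A \<union> \<zeta> ` B))"
    using inf A insert.hyps(1) by (intro Diff_infinite_finite) auto
  then have "{v. g v = g b} - (A \<union> \<zeta> ` B) \<noteq> {}" by (rule infinite_imp_nonempty)
  then obtain w where w: "g w = g b" "w \<notin> A" "w \<notin> \<zeta> ` B" by blast
  have "inj_on (\<zeta>(b := w)) (insert b B)"
    using \<zeta>(1) w(3) insert.hyps(2) by (auto simp: inj_on_def)
  moreover have "(\<zeta>(b := w)) ` insert b B \<inter> A = {}" using \<zeta>(2) w(2) by auto
  moreover have "\<forall>x \<in> insert b B. g ((\<zeta>(b := w)) x) = g x" using \<zeta>(3) w(1) by auto
  ultimately show ?case by blast
qed auto

text \<open>This guarantees that the choice by \<open>SOME\<close> in \<open>avoid_capture\<close>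
  has the intended properties.\<close>

lemma capture_free_bound_variant_exists:
  assumes M: "lc_structure M" and E: "ex_constraint M E"
  shows "\<exists>E'. bound_variant M E E' \<and> capture_free \<sigma> E'"
proof -
  \<comment> \<open>The first part is what \<open>bound_variant\<close> demands to be avoided, the
    second what \<open>capture_free\<close> demands.\<close>
  let ?A = "FVar E \<union> (\<Union>v \<in> FVar E. vars (\<sigma> v))"
  have "finite ?A" by (auto simp: FVar_def finite_vars)
  moreover have "finite (BVar E)" by (simp add: BVar_def)
  moreover have "\<And>\<tau>. infinite {v. var_sort M v = \<tau>}"
    using M by (simp add: lc_structure_def signature_def)
  ultimately obtain \<zeta> where \<zeta>: "inj_on \<zeta> (BVar E)" "\<zeta> ` BVar E \<inter> ?A = {}"
    "\<forall>x \<in> BVar E. var_sort M (\<zeta> x) = var_sort M x"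
    using fresh_sort_preserving_renaming[of "var_sort M" "BVar E" ?A] by blast
  let ?E = "(map \<zeta> (fst E), snd E \<cdot> subst_restrict (\<lambda>v. Var (\<zeta> v)) (BVar E))"
  have bv: "bound_variant M E ?E" using \<zeta> unfolding bound_variant_def by blast
  have "BVar ?E = \<zeta> ` BVar E" by (simp add: BVar_def)
  then have "capture_free \<sigma> ?E"
    using \<zeta>(2) unfolding capture_free_def FVar_bound_variant[OF E bv] by blast
  with bv show ?thesis by blast
qed

text \<open>The substitution lemma for constraints. Every bound variant has the same truth value, so
  the arbitrary choice of variant leaves no trace.\<close>

lemma holds_ex_subst:
  assumes M: "lc_structure M" and E: "ex_constraint M E"
  shows "holds M \<rho> (ex_subst M E \<sigma>) \<longleftrightarrow> holds M (\<lambda>v. evaluate M \<rho> (\<sigma> v)) E"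
proof -
  have ts: "\<And>x. x \<in> BVar E \<Longrightarrow> var_sort M x \<in> theory_sorts M"
    using ex_constraint_theory_sorted[OF M E] E by (auto simp: BVar_def ex_constraint_def)
  show ?thesis
  proof (cases "capture_free \<sigma> E")
    case True
    then show ?thesis using holds_capture_free_subst[OF M ts True]
      by (simp add: ex_subst_def avoid_capture_def)
  next
    case False
    define E' where "E' = avoid_capture M \<sigma> E"
    have E': "bound_variant M E E'" "capture_free \<sigma> E'"
      using someI_ex[OF capture_free_bound_variant_exists[OF M E]] False
      by (auto simp: E'_def avoid_capture_def)
    have ts': "\<And>x. x \<in> BVar E' \<Longrightarrow> var_sort M x \<in> theory_sorts M"
      using E'(1) ts by (auto simp: bound_variant_def BVar_def)
    have "ex_subst M E \<sigma> = (fst E', snd E' \<cdot> subst_restrict \<sigma> (FVar E'))"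
      by (simp add: ex_subst_def E'_def Let_def)
    then show ?thesis
      using holds_capture_free_subst[OF M ts' E'(2)] holds_bound_variant[OF M ts E'(1)] by simp
  qed
qed

section \<open>Valuations as substitutions\<close>

text \<open>Once the free variables are replaced by values, truth no longer depends on the outer
  valuation, and the quantification over all valuations collapses.\<close>

lemma entails_iff_holds:
  assumes M: "lc_structure M" and E: "ex_constraint M E" and \<rho>: "valuation M \<rho>"
    and \<sigma>: "\<And>v. v \<in> FVar E \<Longrightarrow> \<sigma> v = Fun (\<rho> v) []"
  shows "entails M \<sigma> E \<longleftrightarrow> holds M \<rho> E"
proof -
  have B: "\<And>x. x \<in> BVar E \<Longrightarrow> var_sort M x \<in> theory_sorts M"
    using ex_constraint_theory_sorted[OF M E] E by (auto simp: BVar_def ex_constraint_def)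
  have F: "var_sort M v \<in> theory_sorts M" "\<rho> v \<in> carrier M (var_sort M v)" if "v \<in> FVar E" for v
    using ex_constraint_theory_sorted[OF M E] that \<rho> by (auto simp: FVar_def valuation_def)
  have "\<sigma> ` FVar E \<subseteq> Val M" using \<sigma> F by (fastforce simp: Val_def)
  moreover have "holds M \<rho>' (ex_subst M E \<sigma>) \<longleftrightarrow> holds M \<rho> E" for \<rho>'
    unfolding holds_ex_subst[OF M E]
    by (rule holds_cong[OF M B]) (use \<sigma> interp_value[OF M F] in auto)
  \<comment> \<open>The valuation \<open>\<rho>\<close> itself shows that the universal quantifier
    in \<open>entails\<close> is not vacuous.\<close>
  ultimately show ?thesis using \<rho> unfolding entails_def by blast
qed

text \<open>Variables outside \<open>X\<close> stay variables, which are never values. An instance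
  therefore reveals exactly which variables belong to \<open>X\<close>.\<close>

definition valuation_subst :: "('v \<Rightarrow> 'f) \<Rightarrow> 'v set \<Rightarrow> ('f, 'v) subst" where
  "valuation_subst \<rho> X = (\<lambda>v. if v \<in> X then Fun (\<rho> v) [] else Var v)"

lemma valuation_subst_in_Val_iff:
  assumes "valuation M \<rho>" and "\<And>v. v \<in> X \<Longrightarrow> var_sort M v \<in> theory_sorts M"
  shows "valuation_subst \<rho> X v \<in> Val M \<longleftrightarrow> v \<in> X"
proof (cases "v \<in> X")
  case True
  then have "var_sort M v \<in> theory_sorts M" and "\<rho> v \<in> carrier M (var_sort M v)"
    using assms by (auto simp: valuation_def)
  then show ?thesis using True by (auto simp: valuation_subst_def Val_def)
qed (auto simp: valuation_subst_def Val_def)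

lemma substitution_valuation_subst:
  assumes "lc_structure M" and "valuation M \<rho>" and "\<And>v. v \<in> X \<Longrightarrow> var_sort M v \<in> theory_sorts M"
  shows "substitution M (valuation_subst \<rho> X)"
  using assms has_sort_value[OF assms(1)]
  by (auto simp: valuation_subst_def substitution_def valuation_def intro: has_sort.intros)

lemma subsumed_valuation_instance:
  assumes M: "lc_structure M" and S: "ex_constrained_term M (X, s, E)"
    and sub: "subsumed M (X, s, E) (Y, t, F)" and \<rho>: "valuation M \<rho>" and h: "holds M \<rho> E"
  obtains \<gamma> where "valued M Y \<gamma>" and "entails M \<gamma> F" and "s \<cdot> valuation_subst \<rho> X = t \<cdot> \<gamma>"
proof -
  have X: "\<And>v. v \<in> X \<Longrightarrow> var_sort M v \<in> theory_sorts M" and E: "ex_constraint M E" "FVar E \<subseteq> X"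
    using S by (auto simp: ex_constrained_term_def)
  have "entails M (valuation_subst \<rho> X) E"
    using E(2) h by (subst entails_iff_holds[OF M E(1) \<rho>]) (auto simp: valuation_subst_def)
  moreover have "valued M X (valuation_subst \<rho> X)"
    using valuation_subst_in_Val_iff[OF \<rho> X] by (auto simp: valued_def)
  ultimately show thesis
    using sub that substitution_valuation_subst[OF M \<rho> X] unfolding subsumed_def by blast
qed

text \<open>Passing to a sort-preserving bijection \<open>d\<close> on variables turns composition
  with \<open>\<delta>\<close> into composition of functions.\<close>

lemma renamingE:
  assumes "renaming M \<delta>"
  obtains d where "\<delta> = (\<lambda>v. Var (d v))" and "bij d" and "\<And>v. var_sort M (d v) = var_sort M v"
proof -
  have "\<forall>v. \<exists>w. \<delta> v = Var w" using assms by (auto simp: renaming_def bij_betw_def)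
  then obtain d where d: "\<And>v. \<delta> v = Var (d v)" by metis
  have "inj d" using assms d by (auto simp: renaming_def bij_betw_def inj_on_def)
  moreover have "surj d"
  proof -
    have "Var w \<in> range \<delta>" for w using assms by (auto simp: renaming_def bij_betw_def)
    then show ?thesis using d by (metis imageE trm.inject(1) surj_def)
  qed
  moreover have "var_sort M (d v) = var_sort M v" for v
  proof -
    have "has_sort M (Var (d v)) (var_sort M v)"
      using assms d by (metis renaming_def substitution_def)
    then show ?thesis by cases simp
  qed
  ultimately show thesis using that[of d] d by (auto simp: bij_def)
qed

theorem theorem1:
  fixes M :: "('s, 'f, 'v) lc_struct"
    and \<delta> :: "('f, 'v) subst"
    and X Y :: "'v set"
    and s t :: "('f, 'v) trm"
    and xs ys :: "'v list"
    and \<phi> \<psi> :: "('f, 'v) trm"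
  assumes "lc_structure M"
    and "renaming M \<delta>"
    and "ex_constrained_term M (X, s, (xs, \<phi>))"
    and "ex_constrained_term M (Y, t, (ys, \<psi>))"
    and "satisfiable_term M (X, s, (xs, \<phi>))"
    and "satisfiable_term M (Y, t, (ys, \<psi>))"
    and "s \<cdot> \<delta> = t"
  shows "equivalent M (X, s, (xs, \<phi>)) (Y, t, (ys, \<psi>)) \<longleftrightarrow>
    \<delta> ` X = Var ` Y \<and> constraint_equiv M (ex_subst M (xs, \<phi>) \<delta>) (ys, \<psi>)"
proof -
  note M = assms(1) and S = assms(3) and T = assms(4)
  let ?E = "(xs, \<phi>)" and ?F = "(ys, \<psi>)"
  obtain d where d: "\<delta> = (\<lambda>v. Var (d v))" and bij: "bij d"
    and d_sort: "\<And>v. var_sort M (d v) = var_sort M v"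
    using renamingE[OF assms(2)] by blast
  have E: "ex_constraint M ?E" "FVar ?E \<subseteq> X" "X \<subseteq> vars s"
    and F: "ex_constraint M ?F" "FVar ?F \<subseteq> Y" "Y \<subseteq> vars t"
    and X: "\<And>v. v \<in> X \<Longrightarrow> var_sort M v \<in> theory_sorts M"
    and Y: "\<And>v. v \<in> Y \<Longrightarrow> var_sort M v \<in> theory_sorts M"
    using S T by (auto simp: ex_constrained_term_def)
  have vars_t: "vars t = d ` vars s" using assms(7) by (auto simp: vars_subst d)
  \<comment> \<open>Every instance of \<open>t\<close> becomes an instance of \<open>s\<close>, so
    that \<open>subst_eq_iff\<close> can compare the two substitutions variable by variable.\<close>
  have t_subst: "t \<cdot> \<gamma> = s \<cdot> (\<lambda>v. \<gamma> (d v))" for \<gamma>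
    using assms(7) by (auto simp: subst_subst d)
  have image_Var_iff: "\<delta> ` X = Var ` Y \<longleftrightarrow> d ` X = Y"
    by (simp add: d inj_image_eq_iff inj_def flip: image_image[of Var d])
  have E\<delta>: "holds M \<rho> (ex_subst M ?E \<delta>) \<longleftrightarrow> holds M (\<lambda>v. \<rho> (d v)) ?E" for \<rho>
    using holds_ex_subst[OF M E(1)] by (simp add: d)
  have val_d: "valuation M (\<lambda>v. \<rho> (d v))" if "valuation M \<rho>" for \<rho>
    using that d_sort unfolding valuation_def by metis
  \<comment> \<open>Satisfiability supplies one concrete instance on each side; from these the sets
    \<open>X\<close> and \<open>Y\<close> are compared.\<close>
  obtain \<rho>\<^sub>E \<rho>\<^sub>F where \<rho>\<^sub>E: "valuation M \<rho>\<^sub>E" "holds M \<rho>\<^sub>E ?E" and \<rho>\<^sub>F: "valuation M \<rho>\<^sub>F" "holds M \<rho>\<^sub>F ?F"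
    using assms(5,6) by (auto simp: satisfiable_term_def satisfiable_def)
  show ?thesis
    unfolding image_Var_iff
  proof
    assume "equivalent M (X, s, ?E) (Y, t, ?F)"
    then have ST: "subsumed M (X, s, ?E) (Y, t, ?F)" and TS: "subsumed M (Y, t, ?F) (X, s, ?E)"
      by (auto simp: equivalent_def)
    have "v \<in> X \<longleftrightarrow> d v \<in> Y" if v: "v \<in> vars s" for v
    proof
      obtain \<gamma> where \<gamma>: "valued M Y \<gamma>" "s \<cdot> valuation_subst \<rho>\<^sub>E X = t \<cdot> \<gamma>"
        using subsumed_valuation_instance[OF M S ST \<rho>\<^sub>E] by blast
      assume "d v \<in> Y"
      then have "\<gamma> (d v) \<in> Val M" using \<gamma>(1) by (auto simp: valued_def)
      then have "valuation_subst \<rho>\<^sub>E X v \<in> Val M"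
        using \<gamma>(2) v by (auto simp: t_subst subst_eq_iff)
      then show "v \<in> X" using valuation_subst_in_Val_iff[OF \<rho>\<^sub>E(1) X] by simp
    next
      obtain \<sigma> where \<sigma>: "valued M X \<sigma>" "t \<cdot> valuation_subst \<rho>\<^sub>F Y = s \<cdot> \<sigma>"
        using subsumed_valuation_instance[OF M T TS \<rho>\<^sub>F] by blast
      assume "v \<in> X"
      then have "\<sigma> v \<in> Val M" using \<sigma>(1) by (auto simp: valued_def)
      then have "valuation_subst \<rho>\<^sub>F Y (d v) \<in> Val M"
        using \<sigma>(2) v by (auto simp: t_subst subst_eq_iff)
      then show "d v \<in> Y" using valuation_subst_in_Val_iff[OF \<rho>\<^sub>F(1) Y] by simp
    qed
    then have dX: "d ` X = Y" using E(3) F(3) unfolding vars_t by blast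
    have "holds M (\<lambda>v. \<rho> (d v)) ?E \<longleftrightarrow> holds M \<rho> ?F" if \<rho>: "valuation M \<rho>" for \<rho>
    proof
      assume "holds M (\<lambda>v. \<rho> (d v)) ?E"
      then obtain \<gamma> where \<gamma>: "entails M \<gamma> ?F" "s \<cdot> valuation_subst (\<lambda>v. \<rho> (d v)) X = t \<cdot> \<gamma>"
        using subsumed_valuation_instance[OF M S ST val_d[OF \<rho>]] by blast
      \<comment> \<open>Since \<open>Y\<close> is the image of \<open>X\<close> and \<open>X\<close>
        lies in \<open>vars s\<close>, equality of the instances forces \<open>\<gamma>\<close> to
        act like \<open>\<rho>\<close> on all of \<open>Y\<close>.\<close>
      have "\<gamma> y = Fun (\<rho> y) []" if "y \<in> Y" for y
        using that \<gamma>(2) E(3) unfolding dX[symmetric]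
        by (force simp: t_subst subst_eq_iff valuation_subst_def)
      then show "holds M \<rho> ?F" using \<gamma>(1) F(2) entails_iff_holds[OF M F(1) \<rho>] by blast
    next
      assume "holds M \<rho> ?F"
      then obtain \<sigma> where \<sigma>: "entails M \<sigma> ?E" "t \<cdot> valuation_subst \<rho> Y = s \<cdot> \<sigma>"
        using subsumed_valuation_instance[OF M T TS \<rho>] by blast
      have "\<sigma> v = Fun (\<rho> (d v)) []" if "v \<in> X" for v
        using that \<sigma>(2) E(3) unfolding dX[symmetric]
        by (force simp: t_subst subst_eq_iff valuation_subst_def)
      then show "holds M (\<lambda>v. \<rho> (d v)) ?E"
        using \<sigma>(1) E(2) entails_iff_holds[OF M E(1) val_d[OF \<rho>]] by blast
    qed
    then show "d ` X = Y \<and> constraint_equiv M (ex_subst M ?E \<delta>) ?F"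
      using dX by (simp add: constraint_equiv_def E\<delta>)
  next
    assume "d ` X = Y \<and> constraint_equiv M (ex_subst M ?E \<delta>) ?F"
    then have dX: "d ` X = Y"
      and eqv: "\<And>\<rho>. valuation M \<rho> \<Longrightarrow> holds M (\<lambda>v. \<rho> (d v)) ?E \<longleftrightarrow> holds M \<rho> ?F"
      by (auto simp: constraint_equiv_def E\<delta>)
    \<comment> \<open>A \<open>Y\<close>-valued substitution encodes a valuation on
      \<open>Y\<close>, so the equivalence of constraints under valuations carries over to
      entailment.\<close>
    have entails_eq: "entails M (\<lambda>v. \<gamma> (d v)) ?E \<longleftrightarrow> entails M \<gamma> ?F"
      if \<gamma>: "substitution M \<gamma>" "valued M Y \<gamma>" for \<gamma>
    proof -
      have "\<exists>c. \<gamma> y = Fun c [] \<and> c \<in> carrier M (var_sort M y)" if "y \<in> Y" for y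
      proof -
        have "\<gamma> y \<in> Val M" and "has_sort M (\<gamma> y) (var_sort M y)"
          using \<gamma> that by (auto simp: valued_def substitution_def)
        then show ?thesis by (rule Val_of_sortE[OF M]) blast
      qed
      then obtain c where c: "\<And>y. y \<in> Y \<Longrightarrow> \<gamma> y = Fun (c y) [] \<and> c y \<in> carrier M (var_sort M y)"
        by metis
      \<comment> \<open>Outside \<open>Y\<close> the values of \<open>\<rho>\<^sub>E\<close> serve
        only to complete a valuation: \<open>FVar ?F\<close> lies in \<open>Y\<close>, and
        \<open>d\<close> maps \<open>FVar ?E\<close> into \<open>Y\<close>.\<close>
      define \<rho> where "\<rho> = (\<lambda>y. if y \<in> Y then c y else \<rho>\<^sub>E y)"
      have \<rho>: "valuation M \<rho>" using c \<rho>\<^sub>E(1) by (auto simp: valuation_def \<rho>_def)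
      have \<gamma>_eq: "\<gamma> y = Fun (\<rho> y) []" if "y \<in> Y" for y using c[OF that] that by (simp add: \<rho>_def)
      have "entails M \<gamma> ?F \<longleftrightarrow> holds M \<rho> ?F"
        by (rule entails_iff_holds[OF M F(1) \<rho>]) (use \<gamma>_eq F(2) in auto)
      moreover have "entails M (\<lambda>v. \<gamma> (d v)) ?E \<longleftrightarrow> holds M (\<lambda>v. \<rho> (d v)) ?E"
        by (rule entails_iff_holds[OF M E(1) val_d[OF \<rho>]]) (use \<gamma>_eq E(2) dX in auto)
      ultimately show ?thesis using eqv[OF \<rho>] by simp
    qed
    have "subsumed M (Y, t, ?F) (X, s, ?E)"
    proof -
      have "substitution M (\<lambda>v. \<gamma> (d v)) \<and> valued M X (\<lambda>v. \<gamma> (d v)) \<and>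
          entails M (\<lambda>v. \<gamma> (d v)) ?E \<and> t \<cdot> \<gamma> = s \<cdot> (\<lambda>v. \<gamma> (d v))"
        if "substitution M \<gamma>" "valued M Y \<gamma>" "entails M \<gamma> ?F" for \<gamma>
      proof -
        have "substitution M (\<lambda>v. \<gamma> (d v))"
          using that(1) d_sort unfolding substitution_def by metis
        then show ?thesis using that entails_eq[of \<gamma>] dX t_subst by (auto simp: valued_def)
      qed
      then show ?thesis unfolding subsumed_def by blast
    qed
    moreover have "subsumed M (X, s, ?E) (Y, t, ?F)"
    proof -
      have "\<exists>\<gamma>. substitution M \<gamma> \<and> valued M Y \<gamma> \<and> entails M \<gamma> ?F \<and> s \<cdot> \<sigma> = t \<cdot> \<gamma>"
        if \<sigma>: "substitution M \<sigma>" "valued M X \<sigma>" "entails M \<sigma> ?E" for \<sigma>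
      proof -
        \<comment> \<open>Precomposing with \<open>d\<close> gives back \<open>\<sigma>\<close>, so
          \<open>entails_eq\<close> and \<open>t_subst\<close> apply to this \<open>\<gamma>\<close>
          directly.\<close>
        define \<gamma> where "\<gamma> = (\<lambda>y. \<sigma> (inv d y))"
        have \<gamma>d: "(\<lambda>v. \<gamma> (d v)) = \<sigma>" using bij by (simp add: \<gamma>_def bij_is_inj)
        have "var_sort M (inv d y) = var_sort M y" for y
          using d_sort[of "inv d y"] bij by (simp add: bij_is_surj surj_f_inv_f)
        then have sub: "substitution M \<gamma>" using \<sigma>(1) unfolding substitution_def \<gamma>_def by metis
        have val: "valued M Y \<gamma>"
          using \<sigma>(2) bij unfolding dX[symmetric] by (auto simp: valued_def \<gamma>_def bij_is_inj)
        show ?thesis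
          using sub val entails_eq[OF sub val] \<sigma>(3) t_subst[of \<gamma>] unfolding \<gamma>d by auto
      qed
      then show ?thesis unfolding subsumed_def by blast
    qed
    ultimately show "equivalent M (X, s, ?E) (Y, t, ?F)" by (simp add: equivalent_def)
  qed
qed

end
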